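(* Let $n\ge1$ be an integer. The identity $$V(p)=V_{D_{n+1}}(p)\cap H\qquad\text{for all }p\in A_n$$ holds if and only if $n\in\{1,2,3\}$.
   Context: Let $\mathbf 1=(1,\dots,1)^T\in\mathbb R^{n+1}$ and $H=\{x\in\mathbb R^{n+1}:x\cdot\mathbf 1=0\}$. The lattice $A_n$ is $\mathbb Z^{n+1}\cap H$, and for $p\in A_n$ its Voronoi cell, taken inside $H$, is $V(p)=\{x\in H:\|x-p\|\le\|x-q\|\text{ for all }q\in A_n\}$. The lattice $D_{n+1}$ is $\{x\in\mathbb Z^{n+1}:x\cdot\mathbf 1\text{ is even}\}$, and for $p\in D_{n+1}$ its Voronoi cell is $V_{D_{n+1}}(p)=\{x\in\mathbb R^{n+1}:\|x-p\|\le\|x-q\|\text{ for all }q\in D_{n+1}\}$. Note $A_n\subset D_{n+1}$. *)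

theory Defs
  imports "HOL-Analysis.Analysis"
begin

text \<open>The numeral \<open>1 :: real ^ 'm\<close> is the all-ones vector, and the
  space with \<open>n + 1\<close> coordinates is \<open>real ^ 'm\<close> with \<open>CARD('m) = n + 1\<close>.\<close>

definition hyperplane_H :: "(real ^ 'm) set" where
  "hyperplane_H = {x. x \<bullet> 1 = 0}"

definition integer_lattice :: "(real ^ 'm) set" where
  "integer_lattice = {x. \<forall>i. x $ i \<in> \<int>}"

text \<open>For \<open>CARD('m) = n + 1\<close> this is \<open>A\<close> with index \<open>n\<close>, not \<open>n + 1\<close>:
  the usual index is the rank of the lattice.\<close>

definition lattice_A :: "(real ^ 'm) set" where
  "lattice_A = integer_lattice \<inter> hyperplane_H"

definition lattice_D :: "(real ^ 'm) set" where
  "lattice_D = {x \<in> integer_lattice. \<exists>k::int. even k \<and> x \<bullet> 1 = of_int k}"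

text \<open>Voronoi cell of \<open>p\<close> with respect to the point set \<open>L\<close>, taken inside the
  ambient set \<open>S\<close>.\<close>

definition voronoi_cell :: "'a::real_normed_vector set \<Rightarrow> 'a set \<Rightarrow> 'a \<Rightarrow> 'a set" where
  "voronoi_cell S L p = {x \<in> S. \<forall>q\<in>L. norm (x - p) \<le> norm (x - q)}"

end

theory Submission
  imports Defs
begin

text \<open>After translating by \<open>p\<close>, a point \<open>y\<close> lies in the cell of \<open>0\<close> iff
  \<open>2 (y \<bullet> v) \<le> v \<bullet> v\<close> for all lattice vectors \<open>v\<close>. For \<open>D\<close> this amounts to
  \<open>\<bar>y\<^sub>i\<bar> + \<bar>y\<^sub>j\<bar> \<le> 1\<close> for \<open>i \<noteq> j\<close>, and the roots of \<open>A\<close> give \<open>y\<^sub>i - y\<^sub>j \<le> 1\<close>. If the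
  coordinates of \<open>y\<close> sum to \<open>0\<close>, averaging \<open>y\<^sub>i + y\<^sub>j \<le> 2 + 2 y\<^sub>k\<close> over the \<open>n - 1\<close>
  remaining indices \<open>k\<close> gives \<open>y\<^sub>i + y\<^sub>j \<le> 2 (n - 1) / (n + 1)\<close>, which is at most \<open>1\<close>
  exactly when \<open>n \<le> 3\<close>. Equality holds at the projection of \<open>e\<^sub>i + e\<^sub>j\<close> onto \<open>H\<close>,
  which lies in the \<open>A\<close>-cell of \<open>0\<close> but, for \<open>n > 3\<close>, not in its \<open>D\<close>-cell.\<close>

text \<open>After squaring, the terms quadratic in \<open>x\<close> cancel, so each competitor
  \<open>q\<close> cuts out a half-space.\<close>

lemma norm_diff_le_iff_inner:
  fixes x p q :: "'a::real_inner"
  shows "norm (x - p) \<le> norm (x - q) \<longleftrightarrow> 2 * ((x - p) \<bullet> (q - p)) \<le> (q - p) \<bullet> (q - p)"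
  by (simp add: norm_le inner_diff_left inner_diff_right inner_commute algebra_simps)

lemma inner_one_vec: "x \<bullet> (1 :: real ^ 'm) = (\<Sum>i\<in>UNIV. x $ i)"
  by (simp add: inner_vec_def)

lemma lattice_A_subset_D: "lattice_A \<subseteq> lattice_D"
  unfolding lattice_A_def lattice_D_def hyperplane_H_def by (auto intro: exI[of _ 0])

lemma lattice_D_diff:
  assumes "x \<in> lattice_D" "y \<in> lattice_D"
  shows "x - y \<in> lattice_D"
proof -
  obtain k l :: int where "even k" "even l" "x \<bullet> 1 = of_int k" "y \<bullet> 1 = of_int l"
    using assms unfolding lattice_D_def by blast
  then have "even (k - l)" "(x - y) \<bullet> 1 = of_int (k - l)"
    by (simp_all add: inner_diff_left)
  moreover have "x - y \<in> integer_lattice"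
    using assms unfolding lattice_D_def integer_lattice_def by simp
  ultimately show ?thesis
    unfolding lattice_D_def by blast
qed

lemma abs_le_square_Ints:
  fixes a :: real
  assumes "a \<in> \<int>"
  shows "\<bar>a\<bar> \<le> a\<^sup>2"
proof (cases "a = 0")
  case False
  then have "1 \<le> \<bar>a\<bar>"
    using assms by (rule Ints_nonzero_abs_ge1[rotated])
  then have "\<bar>a\<bar> * 1 \<le> \<bar>a\<bar> * \<bar>a\<bar>"
    by (intro mult_left_mono) auto
  then show ?thesis
    by (simp add: power2_eq_square)
qed simp

lemma inner_le_abs_sum:
  fixes y v :: "real ^ 'm"
  shows "y \<bullet> v \<le> (\<Sum>i\<in>UNIV. \<bar>y $ i\<bar> * \<bar>v $ i\<bar>)"
  unfolding inner_vec_def by (intro sum_mono) (simp add: abs_mult[symmetric])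

lemma inner_self_vec: "v \<bullet> v = (\<Sum>i\<in>UNIV. (v $ i)\<^sup>2)" for v :: "real ^ 'm"
  by (simp add: inner_vec_def power2_eq_square)

text \<open>At most one coordinate of \<open>y\<close> exceeds 1/2 in absolute value. If none does,
  integrality of \<open>v\<close> gives the bound termwise; otherwise, with M the large absolute
  value, all others are at most 1 - M.\<close>

lemma lattice_D_inner_le:
  fixes y v :: "real ^ 'm"
  assumes card: "CARD('m) \<ge> 2" and v: "v \<in> lattice_D"
    and y: "\<And>i j. i \<noteq> j \<Longrightarrow> \<bar>y $ i\<bar> + \<bar>y $ j\<bar> \<le> 1"
  shows "2 * (y \<bullet> v) \<le> v \<bullet> v"
proof -
  have vI: "v $ i \<in> \<int>" for i
    using v by (simp add: lattice_D_def integer_lattice_def)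
  show ?thesis
  proof (cases "\<exists>m. \<bar>y $ m\<bar> > 1 / 2")
    case False
    have "y \<bullet> v \<le> (\<Sum>i\<in>UNIV. \<bar>y $ i\<bar> * \<bar>v $ i\<bar>)"
      by (rule inner_le_abs_sum)
    also have "\<dots> \<le> (\<Sum>i\<in>UNIV. 1 / 2 * (v $ i)\<^sup>2)"
      using False by (intro sum_mono mult_mono abs_le_square_Ints vI) (auto simp: not_less)
    also have "\<dots> = 1 / 2 * (v \<bullet> v)"
      by (simp add: inner_self_vec sum_distrib_left)
    finally show ?thesis by simp
  next
    case True
    then obtain m where m: "\<bar>y $ m\<bar> > 1 / 2" by blast
    define M where "M = \<bar>y $ m\<bar>"
    define a where "a = \<bar>v $ m\<bar>"
    define b where "b = (\<Sum>i\<in>UNIV-{m}. \<bar>v $ i\<bar>)"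
    define c where "c = (\<Sum>i\<in>UNIV-{m}. (v $ i)\<^sup>2)"
    \<comment> \<open>A second index is needed for \<open>M \<le> 1\<close>.\<close>
    have "UNIV \<noteq> {m}"
      using card by (auto dest: arg_cong[where f = card])
    then obtain j where "j \<noteq> m" by blast
    then have M: "1 / 2 < M" "M \<le> 1"
      using m y[of j m] unfolding M_def by auto
    have "y \<bullet> v \<le> (\<Sum>i\<in>UNIV. \<bar>y $ i\<bar> * \<bar>v $ i\<bar>)"
      by (rule inner_le_abs_sum)
    also have "\<dots> = M * a + (\<Sum>i\<in>UNIV-{m}. \<bar>y $ i\<bar> * \<bar>v $ i\<bar>)"
      by (simp add: sum.remove[of UNIV m] M_def a_def)
    also have "(\<Sum>i\<in>UNIV-{m}. \<bar>y $ i\<bar> * \<bar>v $ i\<bar>) \<le> (\<Sum>i\<in>UNIV-{m}. (1 - M) * \<bar>v $ i\<bar>)"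
      using y[of _ m] unfolding M_def by (intro sum_mono mult_right_mono) (auto simp: le_diff_eq)
    also have "\<dots> = (1 - M) * b"
      by (simp add: b_def sum_distrib_left)
    finally have yv: "y \<bullet> v \<le> M * a + (1 - M) * b" by simp
    have vv: "v \<bullet> v = a\<^sup>2 + c"
      by (simp add: inner_self_vec sum.remove[of UNIV m] a_def c_def)
    have "a + b \<le> a\<^sup>2 + c"
      using abs_le_square_Ints[OF vI[of m]] unfolding a_def b_def c_def
      by (intro add_mono sum_mono abs_le_square_Ints vI) auto
    moreover have "2 * a \<le> a\<^sup>2 + c"
    proof (cases "\<exists>j. j \<noteq> m \<and> v $ j \<noteq> 0")
      case True
      then obtain j where j: "j \<noteq> m" "v $ j \<noteq> 0" by blast
      have "1 \<le> \<bar>v $ j\<bar>"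
        using vI j(2) by (rule Ints_nonzero_abs_ge1)
      also have "\<dots> \<le> (v $ j)\<^sup>2"
        by (intro abs_le_square_Ints vI)
      also have "\<dots> \<le> c"
        unfolding c_def using j(1) by (intro member_le_sum) auto
      finally have "1 \<le> c" .
      moreover have "0 \<le> (a - 1)\<^sup>2" by simp
      ultimately show ?thesis
        by (simp add: power2_diff)
    next
      case False
      \<comment> \<open>Here \<open>v\<close> is a multiple of the m-th unit vector. Evenness of its
        coordinate sum excludes a = 1, the only natural number with 2 a > a^2.\<close>
      obtain k :: int where k: "even k" "v \<bullet> 1 = of_int k"
        using v unfolding lattice_D_def by blast
      have "v \<bullet> 1 = v $ m"
        using False by (auto simp: inner_one_vec sum.remove[of UNIV m] intro!: sum.neutral)
      with k have a: "a = of_int \<bar>k\<bar>"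
        by (simp add: a_def)
      have "k = 0 \<or> 2 \<le> \<bar>k\<bar>"
        using k(1) by presburger
      then have "2 * \<bar>k\<bar> \<le> \<bar>k\<bar> * \<bar>k\<bar>"
        using mult_right_mono[of 2 "\<bar>k\<bar>" "\<bar>k\<bar>"] by auto
      then have "real_of_int (2 * \<bar>k\<bar>) \<le> real_of_int (\<bar>k\<bar> * \<bar>k\<bar>)"
        by (simp only: of_int_le_iff)
      then have "2 * a \<le> a * a"
        by (simp add: a)
      moreover have "0 \<le> c"
        unfolding c_def by (intro sum_nonneg) auto
      ultimately show ?thesis
        by (simp add: power2_eq_square)
    qed
    \<comment> \<open>The bound on \<open>2 (y \<bullet> v)\<close> is affine in \<open>M\<close>, so it suffices to check \<open>M = 1/2\<close> and
      \<open>M = 1\<close>.\<close>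
    ultimately have "(2 - 2 * M) * (a + b) + (2 * M - 1) * (2 * a)
        \<le> (2 - 2 * M) * (a\<^sup>2 + c) + (2 * M - 1) * (a\<^sup>2 + c)"
      using M by (intro add_mono[OF mult_left_mono mult_left_mono]) auto
    then show ?thesis
      using yv unfolding vv by (simp add: algebra_simps)
  qed
qed

lemma sum_two_coords_le_1:
  fixes y :: "real ^ 'm"
  assumes card: "CARD('m) \<le> 4" and sum: "(\<Sum>i\<in>UNIV. y $ i) = 0"
    and diff: "\<And>i j. y $ i - y $ j \<le> 1" and "i \<noteq> j"
  shows "y $ i + y $ j \<le> 1"
proof -
  define R where "R = UNIV - {i, j}"
  define s where "s = y $ i + y $ j"
  have "card R \<le> 2"
    using card \<open>i \<noteq> j\<close> by (simp add: R_def card_Diff_subset)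
  then have r: "real (card R) \<le> 2" by linarith
  have "(\<Sum>k\<in>UNIV. y $ k) = s + (\<Sum>k\<in>R. y $ k)"
    using \<open>i \<noteq> j\<close> sum.subset_diff[of "{i, j}" UNIV "\<lambda>k. y $ k"] by (simp add: R_def s_def)
  then have "(\<Sum>k\<in>R. y $ k) = - s"
    using sum by simp
  moreover have "(\<Sum>k\<in>R. s) \<le> (\<Sum>k\<in>R. 2 + 2 * y $ k)"
    using diff[of i] diff[of j] unfolding s_def by (intro sum_mono) (smt (verit))
  ultimately have "real (card R) * s \<le> 2 * real (card R) - 2 * s"
    by (simp add: sum.distrib sum_distrib_left[symmetric])
  \<comment> \<open>The dimension bound enters here: \<open>card R \<le> 2\<close> turns 2 card R
    into at most card R + 2. Not dividing by \<open>card R\<close> also covers empty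
    \<open>R\<close>.\<close>
  then have "(real (card R) + 2) * s \<le> (real (card R) + 2) * 1"
    using r by (simp add: algebra_simps)
  then show ?thesis
    unfolding s_def by (subst (asm) mult_le_cancel_left_pos) auto
qed

text \<open>The left side is the largest of the four signed sums. Differences are bounded by
  assumption, and the hypotheses are invariant under negating \<open>y\<close>, which handles both
  signs of the sum.\<close>

lemma abs_two_coords_le_1:
  fixes y :: "real ^ 'm"
  assumes "CARD('m) \<le> 4" and "(\<Sum>i\<in>UNIV. y $ i) = 0"
    and "\<And>i j. y $ i - y $ j \<le> 1" and "i \<noteq> j"
  shows "\<bar>y $ i\<bar> + \<bar>y $ j\<bar> \<le> 1"
proof -
  have "(- y) $ i - (- y) $ j \<le> 1" for i j
    using assms(3)[of j i] by simp
  then have "(- y) $ i + (- y) $ j \<le> 1"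
    using assms by (intro sum_two_coords_le_1) (auto simp: sum_negf)
  moreover have "y $ i + y $ j \<le> 1"
    using assms by (intro sum_two_coords_le_1)
  ultimately show ?thesis
    using assms(3)[of i j] assms(3)[of j i] by (simp add: abs_if)
qed

lemma voronoi_cell_D_Int_H_subset:
  "voronoi_cell UNIV lattice_D p \<inter> hyperplane_H \<subseteq> voronoi_cell hyperplane_H lattice_A p"
  using lattice_A_subset_D unfolding voronoi_cell_def by auto

lemma voronoi_cell_A_diff_le_1:
  fixes p x :: "real ^ 'm"
  assumes p: "p \<in> lattice_A" and x: "x \<in> voronoi_cell hyperplane_H lattice_A p"
  shows "(x - p) $ i - (x - p) $ j \<le> 1"
proof (cases "i = j")
  case False
  \<comment> \<open>The root \<open>q - p\<close> has squared norm 2, so its half-space is exactly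
    the claimed bound.\<close>
  define q where "q = p + axis i 1 - axis j 1"
  have "q \<in> lattice_A"
    using p unfolding q_def lattice_A_def integer_lattice_def hyperplane_H_def
    by (auto simp: inner_diff_left inner_add_left inner_axis') (simp add: axis_def)
  then have "2 * ((x - p) \<bullet> (q - p)) \<le> (q - p) \<bullet> (q - p)"
    using x unfolding voronoi_cell_def by (simp add: norm_diff_le_iff_inner)
  then show ?thesis
    using False by (simp add: q_def inner_diff_left inner_diff_right inner_axis) (simp add: axis_def)
qed simp

lemma voronoi_cell_A_subset_D:
  fixes p :: "real ^ 'm"
  assumes card: "CARD('m) \<in> {2..4}" and p: "p \<in> lattice_A"
  shows "voronoi_cell hyperplane_H lattice_A p \<subseteq> voronoi_cell UNIV lattice_D p"
proof
  fix x assume x: "x \<in> voronoi_cell hyperplane_H lattice_A p"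
  have "(\<Sum>i\<in>UNIV. (x - p) $ i) = 0"
    using x p unfolding voronoi_cell_def lattice_A_def hyperplane_H_def inner_one_vec[symmetric]
    by (simp add: inner_diff_left)
  then have y: "\<bar>(x - p) $ i\<bar> + \<bar>(x - p) $ j\<bar> \<le> 1" if "i \<noteq> j" for i j
    using card that voronoi_cell_A_diff_le_1[OF p x] by (intro abs_two_coords_le_1) auto
  have "2 * ((x - p) \<bullet> (q - p)) \<le> (q - p) \<bullet> (q - p)" if "q \<in> lattice_D" for q
    using card p lattice_A_subset_D that y by (intro lattice_D_inner_le lattice_D_diff) auto
  then show "x \<in> voronoi_cell UNIV lattice_D p"
    unfolding voronoi_cell_def by (simp add: norm_diff_le_iff_inner)
qed

text \<open>Since the coordinates sum to 0, the left side is a combination of all coordinates with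
  signs 1 or -1, and each signed integer is at most its square.\<close>

lemma lattice_A_two_coords_le:
  fixes v :: "real ^ 'm"
  assumes v: "v \<in> lattice_A" and "a \<noteq> b"
  shows "2 * (v $ a + v $ b) \<le> v \<bullet> v"
proof -
  have vI: "v $ i \<in> \<int>" for i
    using v by (simp add: lattice_A_def integer_lattice_def)
  have "(\<Sum>i\<in>UNIV. v $ i) = 0"
    using v by (simp add: lattice_A_def hyperplane_H_def inner_one_vec)
  then have "(\<Sum>i\<in>UNIV-{a,b}. v $ i) = - (v $ a + v $ b)"
    using \<open>a \<noteq> b\<close> sum.subset_diff[of "{a, b}" UNIV "\<lambda>k. v $ k"] by simp
  then have "2 * (v $ a + v $ b) = (\<Sum>i\<in>UNIV-{a,b}. - v $ i) + (\<Sum>i\<in>{a,b}. v $ i)"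
    using \<open>a \<noteq> b\<close> by (simp add: sum_negf)
  also have "\<dots> \<le> (\<Sum>i\<in>UNIV-{a,b}. (v $ i)\<^sup>2) + (\<Sum>i\<in>{a,b}. (v $ i)\<^sup>2)"
    by (intro add_mono sum_mono order_trans[OF _ abs_le_square_Ints] vI) auto
  also have "\<dots> = v \<bullet> v"
    unfolding inner_self_vec by (rule sum.subset_diff[symmetric]) auto
  finally show ?thesis .
qed

lemma voronoi_cells_0_differ:
  assumes card: "CARD('m::finite) > 4"
  shows "voronoi_cell hyperplane_H lattice_A (0 :: real ^ 'm)
    \<noteq> voronoi_cell UNIV lattice_D 0 \<inter> hyperplane_H"
proof -
  have "\<not> CARD('m) \<le> Suc 0"
    using card by simp
  then obtain a b :: 'm where ab: "a \<noteq> b"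
    using card_le_Suc0_iff_eq[of "UNIV :: 'm set"] by auto
  define N where "N = real CARD('m)"
  have N: "N > 4" using card by (simp add: N_def)
  define q :: "real ^ 'm" where "q = axis a 1 + axis b 1"
  \<comment> \<open>The orthogonal projection of \<open>q\<close> onto H. Vectors of A are
    orthogonal to the all-ones vector, so they have the same inner product with \<open>x\<close> as
    with \<open>q\<close>.\<close>
  define x where "x = q - (2 / N) *\<^sub>R 1"
  have [simp]: "(1 :: real ^ 'm) \<bullet> 1 = N"
    by (simp add: inner_one_vec N_def)
  have q1: "q \<bullet> 1 = 2"
    by (simp add: q_def inner_add_left inner_axis')
  have qq: "q \<bullet> q = 2"
    using ab by (simp add: q_def inner_add_left inner_add_right inner_axis_axis)
  have "x \<in> hyperplane_H"
    using N by (simp add: hyperplane_H_def x_def inner_diff_left q1)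
  moreover have "2 * (x \<bullet> v) \<le> v \<bullet> v" if "v \<in> lattice_A" for v
  proof -
    have "x \<bullet> v = v $ a + v $ b"
      using that by (simp add: x_def q_def inner_diff_left inner_add_left inner_axis'
        lattice_A_def hyperplane_H_def inner_commute[of 1])
    then show ?thesis
      using lattice_A_two_coords_le[OF that ab] by simp
  qed
  ultimately have "x \<in> voronoi_cell hyperplane_H lattice_A 0"
    unfolding voronoi_cell_def using norm_diff_le_iff_inner[of x 0] by simp
  moreover have "x \<notin> voronoi_cell UNIV lattice_D 0"
  proof
    assume "x \<in> voronoi_cell UNIV lattice_D 0"
    moreover have "q \<in> lattice_D"
      unfolding lattice_D_def integer_lattice_def using q1
      by (auto intro!: exI[of _ 2] simp: q_def axis_def)
    \<comment> \<open>The vector \<open>q\<close> itself separates the cells: this inequality reads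
      4 - 8 / N \<le> 2, which fails for N > 4.\<close>
    ultimately have "2 * (x \<bullet> q) \<le> q \<bullet> q"
      unfolding voronoi_cell_def using norm_diff_le_iff_inner[of x 0 q] by auto
    moreover have "x \<bullet> q = 2 - 4 / N"
      by (simp add: x_def inner_diff_left qq q1 inner_commute[of 1])
    ultimately show False
      using N by (simp add: qq field_simps)
  qed
  ultimately show ?thesis by blast
qed

theorem lemma12:
  fixes n :: nat
  assumes "n \<ge> 1" and "CARD('m::finite) = n + 1"
  shows "(\<forall>p \<in> (lattice_A :: (real ^ 'm) set).
            voronoi_cell hyperplane_H lattice_A p =
            voronoi_cell UNIV lattice_D p \<inter> hyperplane_H)
         \<longleftrightarrow> n \<in> {1, 2, 3}"
proof
  assume eq: "\<forall>p \<in> (lattice_A :: (real ^ 'm) set).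
    voronoi_cell hyperplane_H lattice_A p = voronoi_cell UNIV lattice_D p \<inter> hyperplane_H"
  have "(0 :: real ^ 'm) \<in> lattice_A"
    by (simp add: lattice_A_def integer_lattice_def hyperplane_H_def)
  with eq have "\<not> CARD('m) > 4"
    using voronoi_cells_0_differ by blast
  then show "n \<in> {1, 2, 3}"
    using assms by auto
next
  assume "n \<in> {1, 2, 3}"
  then have card: "CARD('m) \<in> {2..4}"
    using assms by auto
  have "voronoi_cell hyperplane_H lattice_A p \<subseteq> hyperplane_H" for p :: "real ^ 'm"
    by (auto simp: voronoi_cell_def)
  then show "\<forall>p \<in> (lattice_A :: (real ^ 'm) set).
    voronoi_cell hyperplane_H lattice_A p = voronoi_cell UNIV lattice_D p \<inter> hyperplane_H"
    using voronoi_cell_A_subset_D[OF card] voronoi_cell_D_Int_H_subset by blast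
qed

end
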